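(* Let $\mathbb{F}$ be an algebraically closed field. Let $$L(\lambda)=\begin{bmatrix} M(\lambda) & K_2(\lambda)^T \\ K_1(\lambda) & 0 \end{bmatrix}$$ be a block full rank pencil over $\mathbb{F}$ and let $N_1(\lambda)$ and $N_2(\lambda)$ be any rational bases dual to $K_1(\lambda)$ and $K_2(\lambda)$, respectively. Let $\Omega\subseteq\mathbb{F}$ be nonempty. If $K_i(\lambda)$ and $N_i(\lambda)$ have full row rank in $\Omega$, for $i=1,2$, then $L(\lambda)$ is a linearization with empty state matrix of the rational matrix $G(\lambda)=N_2(\lambda)M(\lambda)N_1(\lambda)^T$ in $\Omega$.
   Context: A pencil is a polynomial matrix of degree at most $1$. A block full rank pencil is a pencil $L(\lambda)=\begin{bmatrix} M(\lambda) & K_2(\lambda)^T \\ K_1(\lambda) & 0 \end{bmatrix}$ where $K_1(\lambda)$ and $K_2(\lambda)$ are pencils with full row normal rank (full row rank over $\mathbb{F}(\lambda)$). The cases when $K_1$ or $K_2$ is empty (only one block row or only one block column) are included. A rational matrix $H(\lambda)\in\mathbb{F}(\lambda)^{p\times m}$, $p<m$, is a rational basis if it has full row normal rank. Two rational bases $H(\lambda)\in\mathbb{F}(\lambda)^{p\times m}$ and $N(\lambda)\in\mathbb{F}(\lambda)^{q\times m}$ are dual if $p+q=m$ and $H(\lambda)N(\lambda)^T=0$. If $K_1$ (resp. $K_2$) is empty, $N_1$ (resp. $N_2$) can be any square rational matrix regular in $\Omega$ whose size is the number of columns (resp. rows) of $M$. A rational matrix $R(\lambda)$ with $p$ rows has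 full row rank in $\Omega\subseteq\mathbb{F}$ if, for all $\lambda_0\in\Omega$, no entry of $R$ has a pole at $\lambda_0$ and $\operatorname{rank}R(\lambda_0)=p$. A square rational matrix is regular at $\lambda_0$ if no entry has a pole at $\lambda_0$ and its determinant is nonzero at $\lambda_0$; it is regular in $\Omega$ if it is regular at every point of $\Omega$. A pencil $L(\lambda)\in\mathbb{F}[\lambda]^{q\times r}$ is a linearization with empty state matrix of a rational matrix $G(\lambda)\in\mathbb{F}(\lambda)^{p\times m}$ in $\Omega$ if for each $\lambda_0\in\Omega$ there exist integers $s_1,s_2\ge0$ with $s_1-s_2=q-p=r-m$ and rational matrices $R_1,R_2$ regular at $\lambda_0$, of sizes $p+s_1$ and $m+s_1$, such that $R_1(\lambda)\,\mathrm{diag}(G(\lambda),I_{s_1})\,R_2(\lambda)=\mathrm{diag}(L(\lambda),I_{s_2})$. *)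

theory Defs
  imports
    "Jordan_Normal_Form.DL_Rank"
    "HOL-Computational_Algebra.Polynomial_Factorial"
begin

text \<open>
  The field of rational functions over a field \<open>'a\<close> is \<^typ>\<open>'a poly fract\<close>; a rational matrix is a
  matrix over it.  Matrices may have zero rows or columns, so an empty block is an actual matrix
  with \<open>dim_row = 0\<close> and the number of columns its position requires.
\<close>

type_synonym 'a ratfun = "'a poly fract"

abbreviation rat_mat :: "'a::field poly mat \<Rightarrow> 'a ratfun mat" where
  "rat_mat A \<equiv> map_mat to_fract A"


subsection \<open>Poles and values of rational functions\<close>

definition has_pole :: "'a::field ratfun \<Rightarrow> 'a \<Rightarrow> bool" where
  "has_pole x a \<longleftrightarrow> (\<exists>p q. q \<noteq> 0 \<and> coprime p q \<and> x = Fract p q \<and> poly q a = 0)"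

text \<open>Only meaningful when \<open>a\<close> is not a pole of \<open>x\<close>.\<close>
definition rat_eval :: "'a::field ratfun \<Rightarrow> 'a \<Rightarrow> 'a" where
  "rat_eval x a = (THE c. \<exists>p q. poly q a \<noteq> 0 \<and> x = Fract p q \<and> c = poly p a / poly q a)"

lemma rat_eval_Fract:
  assumes "poly q a \<noteq> 0"
  shows "rat_eval (Fract p q) a = poly p a / poly q a"
  unfolding rat_eval_def
proof (rule the_equality)
  fix c
  assume "\<exists>p' q'. poly q' a \<noteq> 0 \<and> Fract p q = Fract p' q' \<and> c = poly p' a / poly q' a"
  then obtain p' q' where q': "poly q' a \<noteq> 0" and eq: "Fract p q = Fract p' q'"
    and c: "c = poly p' a / poly q' a"
    by blast
  have "q \<noteq> 0" "q' \<noteq> 0"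
    using assms q' by auto
  then have "p * q' = p' * q"
    using eq by (simp add: eq_fract(1))
  then have "poly p a * poly q' a = poly p' a * poly q a"
    by (metis poly_mult)
  then show "c = poly p a / poly q a"
    using assms q' c by (simp add: frac_eq_eq)
qed (use assms in blast)

lemma has_pole_iff: "has_pole x a \<longleftrightarrow> \<not> (\<exists>p q. x = Fract p q \<and> poly q a \<noteq> 0)"
proof
  assume "has_pole x a"
  then obtain p q where pq: "q \<noteq> 0" "coprime p q" "x = Fract p q" "poly q a = 0"
    unfolding has_pole_def by blast
  show "\<not> (\<exists>p q. x = Fract p q \<and> poly q a \<noteq> 0)"
  proof
    assume "\<exists>p q. x = Fract p q \<and> poly q a \<noteq> 0"
    then obtain p' q' where p'q': "x = Fract p' q'" "poly q' a \<noteq> 0"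
      by blast
    then have "q' \<noteq> 0"
      by auto
    then have eq: "p * q' = p' * q"
      using pq p'q' by (simp add: eq_fract(1))
    then have "poly p a = 0"
      using pq(4) p'q'(2) by (metis mult_eq_0_iff poly_mult)
    then have "[:-a, 1:] dvd p" "[:-a, 1:] dvd q"
      using pq(4) by (simp_all add: poly_eq_0_iff_dvd)
    then have "is_unit [:-a, 1:]"
      using pq(2) coprime_common_divisor by blast
    then show False
      by (simp add: is_unit_pCons_iff)
  qed
next
  assume no_rep: "\<not> (\<exists>p q. x = Fract p q \<and> poly q a \<noteq> 0)"
  let ?P = "\<lambda>n. \<exists>p q. q \<noteq> 0 \<and> x = Fract p q \<and> degree q = n"
  have "\<exists>n. ?P n"
    by (metis Fract_cases)
  then have "?P (LEAST n. ?P n)"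
    by (rule LeastI_ex)
  then obtain p q where pq: "q \<noteq> 0" "x = Fract p q" and deg: "degree q = (LEAST n. ?P n)"
    by blast
  have "coprime p q"
  proof (rule coprimeI)
    fix d assume "d dvd p" "d dvd q"
    then obtain p' q' where d: "p = d * p'" "q = d * q'"
      by (auto elim!: dvdE)
    then have "d \<noteq> 0" "q' \<noteq> 0"
      using pq(1) by auto
    then have "x = Fract p' q'"
      using pq d by (simp add: eq_fract(1))
    then have "(LEAST n. ?P n) \<le> degree q'"
      using \<open>q' \<noteq> 0\<close> by (intro Least_le) blast
    moreover have "degree q = degree d + degree q'"
      using d \<open>d \<noteq> 0\<close> \<open>q' \<noteq> 0\<close> by (simp add: degree_mult_eq)
    ultimately have "degree d = 0"
      using deg by simp
    then show "is_unit d"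
      using \<open>d \<noteq> 0\<close> by (simp add: is_unit_iff_degree)
  qed
  then show "has_pole x a"
    using pq no_rep unfolding has_pole_def by blast
qed


subsection \<open>Rational matrices\<close>

definition no_pole_mat :: "'a::field ratfun mat \<Rightarrow> 'a \<Rightarrow> bool" where
  "no_pole_mat R a \<longleftrightarrow> (\<forall>i < dim_row R. \<forall>j < dim_col R. \<not> has_pole (R $$ (i, j)) a)"

abbreviation eval_mat :: "'a::field ratfun mat \<Rightarrow> 'a \<Rightarrow> 'a mat" where
  "eval_mat R a \<equiv> map_mat (\<lambda>x. rat_eval x a) R"

text \<open>\<^const>\<open>vec_space.rank\<close> takes the number of rows of the matrix as its dimension parameter.\<close>
abbreviation mat_rank :: "'b::field mat \<Rightarrow> nat" where
  "mat_rank A \<equiv> vec_space.rank (dim_row A) A"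

definition full_row_normal_rank :: "'a::field ratfun mat \<Rightarrow> bool" where
  "full_row_normal_rank R \<longleftrightarrow> mat_rank R = dim_row R"

definition full_row_rank_in :: "'a::field ratfun mat \<Rightarrow> 'a set \<Rightarrow> bool" where
  "full_row_rank_in R \<Omega> \<longleftrightarrow> (\<forall>a\<in>\<Omega>. no_pole_mat R a \<and> mat_rank (eval_mat R a) = dim_row R)"

definition regular_at :: "'a::field ratfun mat \<Rightarrow> 'a \<Rightarrow> bool" where
  "regular_at R a \<longleftrightarrow> square_mat R \<and> no_pole_mat R a \<and> rat_eval (det R) a \<noteq> 0"

definition regular_in :: "'a::field ratfun mat \<Rightarrow> 'a set \<Rightarrow> bool" where
  "regular_in R \<Omega> \<longleftrightarrow> (\<forall>a\<in>\<Omega>. regular_at R a)"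

definition rational_basis :: "'a::field ratfun mat \<Rightarrow> bool" where
  "rational_basis H \<longleftrightarrow> dim_row H < dim_col H \<and> full_row_normal_rank H"

definition dual_bases :: "'a::field ratfun mat \<Rightarrow> 'a ratfun mat \<Rightarrow> bool" where
  "dual_bases H N \<longleftrightarrow>
     rational_basis H \<and> rational_basis N \<and>
     dim_col H = dim_col N \<and> dim_row H + dim_row N = dim_col H \<and>
     H * transpose_mat N = 0\<^sub>m (dim_row H) (dim_row N)"

text \<open>
  Duality of \<open>N\<close> to the block \<open>K\<close>, with the convention for empty \<open>K\<close>: there \<open>N\<close> may be any square
  matrix that is regular in \<open>\<Omega>\<close> and has as many columns as \<open>K\<close>.
\<close>
definition dual_to_in :: "'a::field ratfun mat \<Rightarrow> 'a poly mat \<Rightarrow> 'a set \<Rightarrow> bool" where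
  "dual_to_in N K \<Omega> \<longleftrightarrow>
     (if dim_row K = 0 then N \<in> carrier_mat (dim_col K) (dim_col K) \<and> regular_in N \<Omega>
      else dual_bases (rat_mat K) N)"


subsection \<open>Pencils and linearizations\<close>

definition pencil :: "'a::field poly mat \<Rightarrow> bool" where
  "pencil A \<longleftrightarrow> (\<forall>i < dim_row A. \<forall>j < dim_col A. degree (A $$ (i, j)) \<le> 1)"

definition block_full_rank_pencil ::
    "'a::field poly mat \<Rightarrow> 'a poly mat \<Rightarrow> 'a poly mat \<Rightarrow> 'a poly mat \<Rightarrow> bool" where
  "block_full_rank_pencil L M K1 K2 \<longleftrightarrow>
     dim_col K1 = dim_col M \<and> dim_col K2 = dim_row M \<and>
     L = four_block_mat M (transpose_mat K2) K1 (0\<^sub>m (dim_row K1) (dim_row K2)) \<and>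
     pencil L \<and> pencil K1 \<and> pencil K2 \<and>
     full_row_normal_rank (rat_mat K1) \<and> full_row_normal_rank (rat_mat K2)"

definition linearization_empty_state_in ::
    "'a::field poly mat \<Rightarrow> 'a ratfun mat \<Rightarrow> 'a set \<Rightarrow> bool" where
  "linearization_empty_state_in L G \<Omega> \<longleftrightarrow>
     pencil L \<and>
     (\<forall>a\<in>\<Omega>. \<exists>(s1::nat) (s2::nat) R1 R2.
        int s1 - int s2 = int (dim_row L) - int (dim_row G) \<and>
        int s1 - int s2 = int (dim_col L) - int (dim_col G) \<and>
        R1 \<in> carrier_mat (dim_row G + s1) (dim_row G + s1) \<and> regular_at R1 a \<and>
        R2 \<in> carrier_mat (dim_col G + s1) (dim_col G + s1) \<and> regular_at R2 a \<and>
        R1 * diag_block_mat [G, 1\<^sub>m s1] * R2 = diag_block_mat [rat_mat L, 1\<^sub>m s2])"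

end

theory Submission
  imports Defs
begin

text \<open>
  Fix \<open>a \<in> \<Omega>\<close> and work over the local ring of rational functions without pole at \<open>a\<close>.  Full row
  rank at \<open>a\<close> gives \<open>K\<^sub>1\<close> and \<open>N\<^sub>1\<close> right inverses over this ring, and duality turns them into
  an identity \<open>N\<^sub>1\<^sup>T Z\<^sub>1 + Y\<^sub>1 K\<^sub>1 = I\<close> over this ring; similarly for \<open>K\<^sub>2\<close> and \<open>N\<^sub>2\<close>.  These two
  identities alone yield, with \<open>s\<^sub>2 = 0\<close>, the factorization
  \<open>L = R\<^sub>1 diag(G, I) R\<^sub>2\<close> in which \<open>R\<^sub>1 = [Z\<^sub>2\<^sup>T, K\<^sub>2\<^sup>T, Z\<^sub>2\<^sup>T N\<^sub>2 M Y\<^sub>1; 0, 0, I]\<close> and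
  \<open>R\<^sub>2 = [Z\<^sub>1, 0; Y\<^sub>2\<^sup>T M, I; K\<^sub>1, 0]\<close>, and also explicit inverses of \<open>R\<^sub>1\<close> and \<open>R\<^sub>2\<close>.
\<close>

subsection \<open>Pole-free rational functions\<close>

lemma no_pole_cases:
  assumes "\<not> has_pole x a"
  obtains p q where "x = Fract p q" "poly q a \<noteq> 0" "rat_eval x a = poly p a / poly q a"
  using assms rat_eval_Fract unfolding has_pole_iff by metis

lemma no_pole_Fract: "poly q a \<noteq> 0 \<Longrightarrow> \<not> has_pole (Fract p q) a"
  unfolding has_pole_iff by blast

lemma no_pole_to_fract [simp]: "\<not> has_pole (to_fract p) a"
  unfolding to_fract_def by (rule no_pole_Fract) simp

lemma rat_eval_to_fract [simp]: "rat_eval (to_fract p) a = poly p a"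
  unfolding to_fract_def by (subst rat_eval_Fract) simp_all

lemma no_pole_0 [simp]: "\<not> has_pole 0 a" and rat_eval_0 [simp]: "rat_eval 0 a = 0"
  using no_pole_to_fract[of 0] rat_eval_to_fract[of 0] by simp_all

lemma no_pole_1 [simp]: "\<not> has_pole 1 a" and rat_eval_1 [simp]: "rat_eval 1 a = 1"
  using no_pole_to_fract[of 1] rat_eval_to_fract[of 1] by simp_all

lemma
  assumes "\<not> has_pole x a" "\<not> has_pole y a"
  shows no_pole_add: "\<not> has_pole (x + y) a"
    and rat_eval_add: "rat_eval (x + y) a = rat_eval x a + rat_eval y a"
    and no_pole_mult: "\<not> has_pole (x * y) a"
    and rat_eval_mult: "rat_eval (x * y) a = rat_eval x a * rat_eval y a"
proof -
  obtain p q where x: "x = Fract p q" "poly q a \<noteq> 0" "rat_eval x a = poly p a / poly q a"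
    using assms(1) by (rule no_pole_cases)
  obtain r s where y: "y = Fract r s" "poly s a \<noteq> 0" "rat_eval y a = poly r a / poly s a"
    using assms(2) by (rule no_pole_cases)
  have "q \<noteq> 0" "s \<noteq> 0"
    using x y by auto
  then have sum: "x + y = Fract (p * s + r * q) (q * s)" and prod: "x * y = Fract (p * r) (q * s)"
    using x y by simp_all
  have qs: "poly (q * s) a \<noteq> 0"
    using x y by simp
  show "\<not> has_pole (x + y) a" "\<not> has_pole (x * y) a"
    using qs unfolding sum prod by (rule no_pole_Fract)+
  show "rat_eval (x + y) a = rat_eval x a + rat_eval y a"
    using x y unfolding sum rat_eval_Fract[OF qs] by (simp add: field_simps)
  show "rat_eval (x * y) a = rat_eval x a * rat_eval y a"
    using x y unfolding prod rat_eval_Fract[OF qs] by simp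
qed

lemma no_pole_uminus: "\<not> has_pole (- x) a" if "\<not> has_pole x a"
  using no_pole_mult[OF no_pole_to_fract[of "-1"] that] by simp

text \<open>A nonzero value at \<open>a\<close> means that the numerator does not vanish there, so
  exchanging numerator and denominator gives a fraction without pole: such functions are the units
  of the local ring at \<open>a\<close>.\<close>

lemma no_pole_inverse: "\<not> has_pole (inverse x) a" if x: "\<not> has_pole x a" "rat_eval x a \<noteq> 0"
proof -
  obtain p q where pq: "x = Fract p q" "poly q a \<noteq> 0" "rat_eval x a = poly p a / poly q a"
    using x(1) by (rule no_pole_cases)
  then show ?thesis
    using x(2) by (auto intro!: no_pole_Fract)
qed

lemma
  assumes "\<And>i. i \<in> I \<Longrightarrow> \<not> has_pole (f i) a"
  shows no_pole_sum: "\<not> has_pole (sum f I) a"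
    and rat_eval_sum: "rat_eval (sum f I) a = (\<Sum>i\<in>I. rat_eval (f i) a)"
proof -
  have "\<not> has_pole (sum f I) a \<and> rat_eval (sum f I) a = (\<Sum>i\<in>I. rat_eval (f i) a)"
    using assms
    by (induction I rule: infinite_finite_induct) (simp_all add: no_pole_add rat_eval_add)
  then show "\<not> has_pole (sum f I) a" "rat_eval (sum f I) a = (\<Sum>i\<in>I. rat_eval (f i) a)"
    by simp_all
qed

lemma
  assumes "\<And>i. i \<in> I \<Longrightarrow> \<not> has_pole (f i) a"
  shows no_pole_prod: "\<not> has_pole (prod f I) a"
    and rat_eval_prod: "rat_eval (prod f I) a = (\<Prod>i\<in>I. rat_eval (f i) a)"
proof -
  have "\<not> has_pole (prod f I) a \<and> rat_eval (prod f I) a = (\<Prod>i\<in>I. rat_eval (f i) a)"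
    using assms
    by (induction I rule: infinite_finite_induct) (simp_all add: no_pole_mult rat_eval_mult)
  then show "\<not> has_pole (prod f I) a" "rat_eval (prod f I) a = (\<Prod>i\<in>I. rat_eval (f i) a)"
    by simp_all
qed

lemma
  shows no_pole_signof: "\<not> has_pole (signof p) a"
    and rat_eval_signof: "rat_eval (signof p) a = signof p"
proof -
  \<comment> \<open>A sign is an embedded constant polynomial, so the facts about
    \<open>to_fract\<close> apply to it.\<close>
  have *: "signof p = (to_fract (signof p) :: 'a ratfun)"
    by (simp add: sign_def)
  show "\<not> has_pole (signof p) a" "rat_eval (signof p) a = signof p"
    by (subst *, simp add: sign_def)+
qed


subsection \<open>Pole-free and regular rational matrices\<close>

lemma no_pole_matI:
  "(\<And>i j. i < dim_row A \<Longrightarrow> j < dim_col A \<Longrightarrow> \<not> has_pole (A $$ (i, j)) a) \<Longrightarrow> no_pole_mat A a"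
  unfolding no_pole_mat_def by blast

lemma no_pole_matD:
  "no_pole_mat A a \<Longrightarrow> i < dim_row A \<Longrightarrow> j < dim_col A \<Longrightarrow> \<not> has_pole (A $$ (i, j)) a"
  unfolding no_pole_mat_def by blast

lemma no_pole_rat_mat [simp]: "no_pole_mat (rat_mat A) a"
  by (rule no_pole_matI) simp

lemma no_pole_zero_mat [simp]: "no_pole_mat (0\<^sub>m n m) a"
  by (rule no_pole_matI) simp

lemma no_pole_one_mat [simp]: "no_pole_mat (1\<^sub>m n) a"
  by (rule no_pole_matI) simp

lemma no_pole_transpose_mat: "no_pole_mat A a \<Longrightarrow> no_pole_mat (transpose_mat A) a"
  unfolding no_pole_mat_def by simp

lemma no_pole_uminus_mat: "no_pole_mat A a \<Longrightarrow> no_pole_mat (- A) a"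
  unfolding no_pole_mat_def by (simp add: no_pole_uminus)

lemma no_pole_minus_mat:
  "no_pole_mat A a \<Longrightarrow> no_pole_mat B a \<Longrightarrow> dim_row A = dim_row B \<Longrightarrow> dim_col A = dim_col B \<Longrightarrow>
    no_pole_mat (A - B) a"
  unfolding no_pole_mat_def
  by (simp add: diff_conv_add_uminus no_pole_add no_pole_uminus del: add_uminus_conv_diff)

text \<open>Evaluation at \<open>a\<close> is a ring homomorphism on the functions without pole at
  \<open>a\<close>, and each entry of the product is a finite sum of products of such
  functions.\<close>

lemma
  assumes "no_pole_mat A a" "no_pole_mat B a" "dim_col A = dim_row B"
  shows no_pole_times_mat: "no_pole_mat (A * B) a"
    and eval_times_mat: "eval_mat (A * B) a = eval_mat A a * eval_mat B a"
proof -
  have entry: "\<not> has_pole (A $$ (i, k) * B $$ (k, j)) a"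
    if "i < dim_row A" "j < dim_col B" "k < dim_row B" for i j k
    using that assms by (intro no_pole_mult) (simp_all add: no_pole_matD)
  show "no_pole_mat (A * B) a"
    using assms entry by (intro no_pole_matI) (auto simp: scalar_prod_def intro!: no_pole_sum)
  show "eval_mat (A * B) a = eval_mat A a * eval_mat B a"
  proof (rule eq_matI)
    fix i j
    assume "i < dim_row (eval_mat A a * eval_mat B a)" "j < dim_col (eval_mat A a * eval_mat B a)"
    then show "eval_mat (A * B) a $$ (i, j) = (eval_mat A a * eval_mat B a) $$ (i, j)"
      using assms entry
      by (auto simp: scalar_prod_def rat_eval_mult no_pole_matD
          intro!: trans[OF rat_eval_sum] sum.cong)
  qed simp_all
qed

lemma no_pole_four_block_mat:
  assumes "no_pole_mat A a" "no_pole_mat B a" "no_pole_mat C a" "no_pole_mat D a"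
    and "dim_row B = dim_row A" "dim_col C = dim_col A"
    and "dim_row D = dim_row C" "dim_col D = dim_col B"
  shows "no_pole_mat (four_block_mat A B C D) a"
  using assms by (intro no_pole_matI) (simp add: no_pole_matD)

section \<open>Determinants, adjugates and inverses over the local ring at a point\<close>

lemma
  assumes A: "A \<in> carrier_mat n n" and np: "no_pole_mat A a"
  shows no_pole_det: "\<not> has_pole (det A) a"
    and rat_eval_det: "rat_eval (det A) a = det (eval_mat A a)"
proof -
  have entry: "\<not> has_pole (A $$ (i, p i)) a" if "p permutes {0..<n}" "i < n" for p i
    using that A np by (intro no_pole_matD) (auto simp: permutes_in_image)
  have term_np: "\<not> has_pole (signof p * (\<Prod>i = 0..<n. A $$ (i, p i))) a"
    if "p permutes {0..<n}" for p
    using that entry by (intro no_pole_mult no_pole_signof no_pole_prod) simp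
  show "\<not> has_pole (det A) a"
    using term_np by (auto simp: det_def'[OF A] intro!: no_pole_sum)
  have "rat_eval (signof p * (\<Prod>i = 0..<n. A $$ (i, p i))) a
      = signof p * (\<Prod>i = 0..<n. eval_mat A a $$ (i, p i))" if p: "p permutes {0..<n}" for p
  proof -
    have "eval_mat A a $$ (i, p i) = rat_eval (A $$ (i, p i)) a" if "i < n" for i
      using that A p permutes_in_image[OF p, of i] by simp
    then show ?thesis
      using entry[OF p] rat_eval_prod[of "{0..<n}" "\<lambda>i. A $$ (i, p i)" a]
      by (subst rat_eval_mult) (auto simp: no_pole_signof rat_eval_signof intro!: no_pole_prod)
  qed
  then show "rat_eval (det A) a = det (eval_mat A a)"
    using A term_np by (auto simp: det_def' intro!: trans[OF rat_eval_sum] sum.cong)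
qed

text \<open>Up to sign, each entry of the adjugate is the determinant of a submatrix of
  \<open>A\<close>, hence a polynomial expression in pole-free entries.\<close>

lemma no_pole_adj_mat:
  assumes A: "A \<in> carrier_mat n n" and np: "no_pole_mat A a"
  shows "no_pole_mat (adj_mat A) a"
proof (rule no_pole_matI)
  fix i j
  assume "i < dim_row (adj_mat A)" "j < dim_col (adj_mat A)"
  then have ij: "i < n" "j < n"
    using A by (simp_all add: adj_mat_def)
  have del: "mat_delete A j i \<in> carrier_mat (n - 1) (n - 1)"
    using A by (rule mat_delete_carrier)
  have "no_pole_mat (mat_delete A j i) a"
    using A np ij unfolding no_pole_mat_def by (auto simp: mat_delete_def)
  then have "\<not> has_pole (det (mat_delete A j i)) a"
    by (rule no_pole_det[OF del])
  moreover have "\<not> has_pole ((-1) ^ (j + i)) a"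
    by (cases "even (j + i)") (simp_all add: no_pole_uminus)
  ultimately show "\<not> has_pole (adj_mat A $$ (i, j)) a"
    using A ij by (simp add: adj_mat_def cofactor_def no_pole_mult)
qed

text \<open>Regularity makes \<open>det A\<close> a unit of the local ring at \<open>a\<close>, so
  the adjugate formula for the inverse introduces no pole.\<close>

lemma regular_at_obtain_inverse:
  assumes A: "A \<in> carrier_mat n n" and reg: "regular_at A a"
  obtains B where "B \<in> carrier_mat n n" "no_pole_mat B a" "A * B = 1\<^sub>m n"
proof
  have np: "no_pole_mat A a" and det: "rat_eval (det A) a \<noteq> 0"
    using reg by (simp_all add: regular_at_def)
  let ?B = "inverse (det A) \<cdot>\<^sub>m adj_mat A"
  show "?B \<in> carrier_mat n n"
    using adj_mat(1)[OF A] by simp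
  show "no_pole_mat ?B a"
    using no_pole_adj_mat[OF A np] no_pole_inverse[OF no_pole_det[OF A np] det]
    by (intro no_pole_matI) (simp add: no_pole_matD no_pole_mult)
  have "det A \<noteq> 0"
    using det by auto
  then show "A * ?B = 1\<^sub>m n"
    using mult_smult_distrib[OF A adj_mat(1)[OF A]] adj_mat(2)[OF A] by (auto intro!: eq_matI)
qed

text \<open>Evaluating \<open>det A * det B = 1\<close> at \<open>a\<close> shows that neither
  determinant vanishes there. Regularity can therefore be certified by a pole-free inverse on either
  side, without computing a determinant.\<close>

lemma regular_at_if_inverse:
  assumes A: "A \<in> carrier_mat n n" and B: "B \<in> carrier_mat n n"
    and np: "no_pole_mat A a" "no_pole_mat B a" and inv: "A * B = 1\<^sub>m n"
  shows "regular_at A a" "regular_at B a"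
proof -
  have "det A * det B = 1"
    using det_mult[OF A B] inv by simp
  then have "rat_eval (det A) a * rat_eval (det B) a = 1"
    using rat_eval_mult[OF no_pole_det[OF A np(1)] no_pole_det[OF B np(2)]] by simp
  then show "regular_at A a" "regular_at B a"
    using A B np by (auto simp: regular_at_def)
qed


subsection \<open>Block rows and columns\<close>

lemma mult_assoc_dim:
  fixes A :: "'b::semiring_0 mat"
  assumes "dim_col A = dim_row B" "dim_col B = dim_row C"
  shows "A * B * C = A * (B * C)"
  using assms by (intro assoc_mult_mat) auto

text \<open>The recursion of \<open>diag_block_mat\<close> ends in a 0 by 0 block; this equation
  removes it.\<close>

lemma four_block_mat_empty:
  assumes "A \<in> carrier_mat n m"
  shows "four_block_mat A (0\<^sub>m n 0) (0\<^sub>m 0 m) (0\<^sub>m 0 0) = A"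
  using assms by (intro eq_matI) auto

text \<open>The counterpart of \<open>append_rows\<close>, likewise encoded as a 2 by 2 block
  matrix, here with an empty lower block row, so that products of block rows and block columns
  reduce to \<open>mult_four_block_mat\<close>.\<close>

definition append_cols :: "'a::zero mat \<Rightarrow> 'a mat \<Rightarrow> 'a mat" (infixr \<open>@\<^sub>c\<close> 65) where
  "A @\<^sub>c B = four_block_mat A B (0\<^sub>m 0 (dim_col A)) (0\<^sub>m 0 (dim_col B))"

lemma append_cols_carrier [simp, intro]:
  "A \<in> carrier_mat n m1 \<Longrightarrow> B \<in> carrier_mat n m2 \<Longrightarrow> A @\<^sub>c B \<in> carrier_mat n (m1 + m2)"
  unfolding append_cols_def by auto

lemma append_cols_mult_append_rows:
  fixes A :: "'a::comm_ring_1 mat"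
  assumes "A \<in> carrier_mat n a" "B \<in> carrier_mat n b" "C \<in> carrier_mat a m" "D \<in> carrier_mat b m"
  shows "(A @\<^sub>c B) * (C @\<^sub>r D) = A * C + B * D"
proof -
  have "(A @\<^sub>c B) * (C @\<^sub>r D)
    = four_block_mat (A * C + B * D) (A * 0\<^sub>m a 0 + B * 0\<^sub>m b 0)
        (0\<^sub>m 0 a * C + 0\<^sub>m 0 b * D) (0\<^sub>m 0 a * 0\<^sub>m a 0 + 0\<^sub>m 0 b * 0\<^sub>m b 0)"
    unfolding append_cols_def append_rows_def using assms
    by (subst mult_four_block_mat[where ?n1.0 = a and ?n2.0 = b]) auto
  also have "\<dots> = A * C + B * D"
    using assms by (intro eq_matI) auto
  finally show ?thesis .
qed

lemma append_rows_mult_append_cols: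
  fixes A :: "'a::comm_ring_1 mat"
  assumes "A \<in> carrier_mat a n" "B \<in> carrier_mat b n" "C \<in> carrier_mat n c" "D \<in> carrier_mat n d"
  shows "(A @\<^sub>r B) * (C @\<^sub>c D) = four_block_mat (A * C) (A * D) (B * C) (B * D)"
  unfolding append_cols_def append_rows_def using assms
  by (subst mult_four_block_mat[where ?n1.0 = n and ?n2.0 = 0]) auto

lemma no_pole_append_rows:
  "no_pole_mat A a \<Longrightarrow> no_pole_mat B a \<Longrightarrow> dim_col A = dim_col B \<Longrightarrow> no_pole_mat (A @\<^sub>r B) a"
  unfolding append_rows_def by (intro no_pole_four_block_mat) auto

lemma no_pole_append_cols:
  "no_pole_mat A a \<Longrightarrow> no_pole_mat B a \<Longrightarrow> dim_row A = dim_row B \<Longrightarrow> no_pole_mat (A @\<^sub>c B) a"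
  unfolding append_cols_def by (intro no_pole_four_block_mat) auto


subsection \<open>Complementing a dual pair\<close>

text \<open>A maximal independent set of columns has \<open>rank A = n\<close> elements and is
  therefore a basis. Each unit vector is then of the form \<open>A *\<^sub>v x\<close>, and these
  solutions \<open>x\<close> form the columns of the right inverse.\<close>

lemma (in vec_space) full_row_rank_right_inverse:
  assumes A: "A \<in> carrier_mat n nc" and rank: "rank A = n"
  obtains C where "C \<in> carrier_mat nc n" "A * C = 1\<^sub>m n"
proof -
  have "\<exists>x\<in>carrier_vec nc. A *\<^sub>v x = unit_vec n j" if "j < n" for j
  proof -
    have cols: "set (cols A) \<subseteq> carrier_vec n"
      using A cols_dim by blast
    obtain S where max: "maximal S (\<lambda>T. T \<subseteq> set (cols A) \<and> lin_indpt T)" and S: "finite S"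
      using maximal_exists_superset[of "set (cols A)" "\<lambda>T. T \<subseteq> set (cols A) \<and> lin_indpt T" "{}"]
      by (auto simp: finite_lin_indpt2)
    then have "S \<subseteq> set (cols A)" "lin_indpt S"
      by (simp_all add: maximal_def)
    moreover have "card S = n"
      using rank rank_card_indpt[OF A max] by simp
    ultimately have "basis S"
      using cols S by (intro dim_li_is_basis) (auto simp: dim_is_n)
    then have "carrier_vec n \<subseteq> col_space A"
      using span_is_monotone[OF \<open>S \<subseteq> set (cols A)\<close>] unfolding basis_def col_space_def by simp
    then have "unit_vec n j \<in> col_space A"
      by auto
    then show ?thesis
      using A col_space_eq[OF A] by auto
  qed
  then obtain x where x: "\<And>j. j < n \<Longrightarrow> x j \<in> carrier_vec nc \<and> A *\<^sub>v x j = unit_vec n j"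
    by metis
  let ?C = "mat nc n (\<lambda>(i, j). x j $ i)"
  have C: "?C \<in> carrier_mat nc n"
    by simp
  have "col ?C j = x j" if "j < n" for j
    using x[OF that] that by (intro eq_vecI) auto
  then have "A * ?C = 1\<^sub>m n"
    using A x by (intro mat_col_eqI) (simp_all add: col_mult2[OF A C])
  with C show thesis
    by (rule that)
qed


text \<open>A right inverse of the value at \<open>a\<close> lifts to the local ring: regarded as a
  constant matrix \<open>R\<close>, it makes \<open>K * R\<close> evaluate to the identity, so
  \<open>K * R\<close> has a pole-free inverse \<open>E\<close>, and \<open>R * E\<close> is the
  required matrix.\<close>

lemma no_pole_right_inverse:
  assumes K: "K \<in> carrier_mat k m" and np: "no_pole_mat K a"
    and rank: "mat_rank (eval_mat K a) = dim_row K"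
  obtains Y where "Y \<in> carrier_mat m k" "no_pole_mat Y a" "K * Y = 1\<^sub>m k"
proof -
  have "eval_mat K a \<in> carrier_mat k m" "vec_space.rank k (eval_mat K a) = k"
    using K rank by auto
  then obtain C where C: "C \<in> carrier_mat m k" "eval_mat K a * C = 1\<^sub>m k"
    by (rule vec_space.full_row_rank_right_inverse)
  \<comment> \<open>The entries of \<open>C\<close> become constant rational functions, so
    \<open>R\<close> has no poles and takes the value \<open>C\<close> at \<open>a\<close>.\<close>
  define R where "R = map_mat (\<lambda>c. to_fract [:c:]) C"
  have R: "R \<in> carrier_mat m k" and npR: "no_pole_mat R a" and evR: "eval_mat R a = C"
    using C(1) by (auto simp: R_def intro!: no_pole_matI eq_matI)
  have KR: "K * R \<in> carrier_mat k k"
    using K R by simp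
  have npKR: "no_pole_mat (K * R) a" and ev: "eval_mat (K * R) a = 1\<^sub>m k"
    using no_pole_times_mat[OF np npR] eval_times_mat[OF np npR] K R C evR by auto
  have "regular_at (K * R) a"
    using K KR npKR rat_eval_det[OF KR npKR] by (auto simp: regular_at_def ev)
  then obtain E where E: "E \<in> carrier_mat k k" "no_pole_mat E a" "K * R * E = 1\<^sub>m k"
    using regular_at_obtain_inverse[OF KR] by blast
  show thesis
  proof
    show "R * E \<in> carrier_mat m k" "no_pole_mat (R * E) a"
      using R E no_pole_times_mat[OF npR E(2)] by auto
    show "K * (R * E) = 1\<^sub>m k"
      using K R E by (simp flip: assoc_mult_mat)
  qed
qed

text \<open>Replacing the left inverse \<open>Q\<close> of \<open>B\<close> by
  \<open>Q - Q * Y * K\<close> keeps it a left inverse, because \<open>K * B = 0\<close>, and makes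
  it annihilate \<open>Y\<close>, because \<open>K * Y = 1\<close>. Stacked under \<open>K\<close>
  it is then a left inverse of the block row formed by \<open>Y\<close> and \<open>B\<close>. Both
  matrices are square of size \<open>k + q = m\<close>, so they also multiply to the identity in the
  other order, which is the claim.\<close>

lemma dual_pair_bezout:
  fixes K :: "'b::field mat"
  assumes K: "K \<in> carrier_mat k m" and B: "B \<in> carrier_mat m q" and "k + q = m"
    and Y: "Y \<in> carrier_mat m k" and Q: "Q \<in> carrier_mat q m"
    and KB: "K * B = 0\<^sub>m k q" and KY: "K * Y = 1\<^sub>m k" and QB: "Q * B = 1\<^sub>m q"
  shows "B * (Q - Q * Y * K) + Y * K = 1\<^sub>m m"
proof -
  let ?Z = "Q - Q * Y * K"
  have Z: "?Z \<in> carrier_mat q m"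
    using K Y Q by auto
  have ZY: "?Z * Y = 0\<^sub>m q k"
  proof -
    have "?Z * Y = Q * Y - Q * Y * (K * Y)"
      using K Y Q by (subst minus_mult_distrib_mat[of _ q m]) (auto simp: mult_assoc_dim)
    also have "\<dots> = 0\<^sub>m q k"
      using Y Q by (simp add: KY)
    finally show ?thesis .
  qed
  have ZB: "?Z * B = 1\<^sub>m q"
  proof -
    have "?Z * B = Q * B - Q * Y * (K * B)"
      using K Y Q B by (subst minus_mult_distrib_mat[of _ q m]) (auto simp: mult_assoc_dim)
    also have "\<dots> = 1\<^sub>m q"
      using Y Q by (auto simp: KB QB intro!: eq_matI)
    finally show ?thesis .
  qed
  have "(K @\<^sub>r ?Z) * (Y @\<^sub>c B) = 1\<^sub>m (k + q)"
    using append_rows_mult_append_cols[OF K Z Y B] by (simp add: KY KB ZY ZB)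
  moreover have "K @\<^sub>r ?Z \<in> carrier_mat m m" "Y @\<^sub>c B \<in> carrier_mat m m"
    using carrier_append_rows[OF K Z] append_cols_carrier[OF Y B] \<open>k + q = m\<close> by auto
  \<comment> \<open>Over a field, a one-sided inverse of a square matrix is two-sided.\<close>
  ultimately have "(Y @\<^sub>c B) * (K @\<^sub>r ?Z) = 1\<^sub>m m"
    using \<open>k + q = m\<close> by (auto intro: mat_mult_left_right_inverse[of "K @\<^sub>r ?Z"])
  then have "Y * K + B * ?Z = 1\<^sub>m m"
    unfolding append_cols_mult_append_rows[OF Y B K Z] .
  moreover have "B * ?Z + Y * K = Y * K + B * ?Z"
    using B Z Y K by (intro comm_add_mat[of _ m m] mult_carrier_mat)
  ultimately show ?thesis
    by (simp only:)
qed

text \<open>The right inverses of \<open>K\<close> and \<open>N\<close> supplied by full row rank at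
  \<open>a\<close> feed \<open>dual_pair_bezout\<close> with \<open>B = transpose_mat N\<close>; the
  transposed right inverse of \<open>N\<close> serves as \<open>Q\<close>. The correction of
  \<open>Q\<close> uses only products and a difference, so no pole arises.\<close>

lemma no_pole_dual_bezout:
  assumes K: "K \<in> carrier_mat k m" and N: "N \<in> carrier_mat q m" and "k + q = m"
    and KN: "K * transpose_mat N = 0\<^sub>m k q"
    and rankK: "full_row_rank_in K \<Omega>" and rankN: "full_row_rank_in N \<Omega>" and a: "a \<in> \<Omega>"
  obtains Y Z where "Y \<in> carrier_mat m k" "Z \<in> carrier_mat q m" "no_pole_mat Y a" "no_pole_mat Z a"
    "transpose_mat N * Z + Y * K = 1\<^sub>m m"
proof -
  have npK: "no_pole_mat K a"
    using rankK a by (simp add: full_row_rank_in_def)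
  obtain Y where Y: "Y \<in> carrier_mat m k" "no_pole_mat Y a" "K * Y = 1\<^sub>m k"
    using no_pole_right_inverse[OF K] rankK a by (auto simp: full_row_rank_in_def)
  obtain X where X: "X \<in> carrier_mat m q" "no_pole_mat X a" "N * X = 1\<^sub>m q"
    using no_pole_right_inverse[OF N] rankN a by (auto simp: full_row_rank_in_def)
  let ?Q = "transpose_mat X"
  have Q: "?Q \<in> carrier_mat q m" and QN: "?Q * transpose_mat N = 1\<^sub>m q"
    using X N by (simp_all flip: transpose_mult[OF N X(1)])
  have npQ: "no_pole_mat ?Q a"
    using X by (simp add: no_pole_transpose_mat)
  let ?Z = "?Q - ?Q * Y * K"
  have "no_pole_mat ?Z a"
    using K Y Q npK npQ by (intro no_pole_minus_mat no_pole_times_mat) auto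
  moreover have "transpose_mat N * ?Z + Y * K = 1\<^sub>m m"
    using K N Y Q KN QN \<open>k + q = m\<close> by (intro dual_pair_bezout) auto
  moreover have "?Z \<in> carrier_mat q m"
    using K Y Q by auto
  ultimately show thesis
    using Y that by blast
qed


subsection \<open>The block factorization\<close>

text \<open>Only the upper left block needs the two identities. It equals
  \<open>P * N * M * (B * Z + Y * K) + F * V * M\<close>, which the first identity turns into
  \<open>(P * N + F * V) * M\<close> and the second into \<open>M\<close>. The other blocks
  \<open>F\<close>, \<open>K\<close> and 0 are picked out by the identity and zero blocks of the
  outer factors.\<close>

lemma block_factorization:
  fixes M :: "'b::comm_ring_1 mat"
  assumes M: "M \<in> carrier_mat n m"
    and B: "B \<in> carrier_mat m q" and Z: "Z \<in> carrier_mat q m"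
    and Y: "Y \<in> carrier_mat m k" and K: "K \<in> carrier_mat k m"
    and P: "P \<in> carrier_mat n p" and N: "N \<in> carrier_mat p n"
    and F: "F \<in> carrier_mat n l" and V: "V \<in> carrier_mat l n"
    and bezout1: "B * Z + Y * K = 1\<^sub>m m" and bezout2: "P * N + F * V = 1\<^sub>m n"
  shows "four_block_mat P (F @\<^sub>c P * (N * M * Y)) (0\<^sub>m k p) (0\<^sub>m k l @\<^sub>c 1\<^sub>m k)
      * four_block_mat (N * M * B) (0\<^sub>m p (l + k)) (0\<^sub>m (l + k) q) (1\<^sub>m (l + k))
      * four_block_mat Z (0\<^sub>m q l) (V * M @\<^sub>r K) (1\<^sub>m l @\<^sub>r 0\<^sub>m k l)
    = four_block_mat M F K (0\<^sub>m k l)"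
    (is "four_block_mat P ?C _ ?D * four_block_mat ?G _ _ _ * four_block_mat Z _ ?Q ?J = _")
proof -
  note carriers = M B Z Y K P N F V
  let ?X = "P * (N * M)"
  have X: "?X \<in> carrier_mat n m"
    using carriers by auto
  have "?X * (B * Z) + ?X * (Y * K) = ?X * (B * Z + Y * K)"
    using X B Z Y K by (intro mult_add_distrib_mat[symmetric]) auto
  then have "?X * (B * Z) + ?X * (Y * K) = ?X"
    unfolding bezout1 right_mult_one_mat[OF X] .
  moreover have "?X + F * (V * M) = (P * N + F * V) * M"
    using carriers by (simp add: add_mult_distrib_mat[of _ n n] mult_assoc_dim)
  moreover have "?X * (B * Z) + (F * (V * M) + ?X * (Y * K))
      = ?X * (B * Z) + ?X * (Y * K) + F * (V * M)"
  proof -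
    have "S + (U + T) = S + T + U"
      if "S \<in> carrier_mat n m" "T \<in> carrier_mat n m" "U \<in> carrier_mat n m" for S T U :: "'b mat"
      using that by (intro eq_matI) (auto simp: ac_simps)
    then show ?thesis
      using X carriers by (meson mult_carrier_mat)
  qed
  ultimately have upper_left: "P * ?G * Z + (F * (V * M) + P * (N * M * Y) * K) = M"
    using carriers bezout2 by (simp add: mult_assoc_dim)
  have PC: "P * (N * M * Y) \<in> carrier_mat n k" and VM: "V * M \<in> carrier_mat l m"
    using carriers by auto
  have products: "?C * ?Q = F * (V * M) + P * (N * M * Y) * K" "?C * ?J = F"
    "?D * ?Q = K" "?D * ?J = 0\<^sub>m k l"
    using F PC VM K
    by (simp_all add: append_cols_mult_append_rows[of _ n l _ k _ m]
        append_cols_mult_append_rows[of _ n l _ k _ l]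
        append_cols_mult_append_rows[of _ k l _ k _ m]
        append_cols_mult_append_rows[of _ k l _ k _ l]
        right_mult_zero_mat[OF PC] left_mult_zero_mat[OF VM])
  have G: "?G \<in> carrier_mat p q" and PG: "P * ?G \<in> carrier_mat n q"
    and C: "?C \<in> carrier_mat n (l + k)" and D: "?D \<in> carrier_mat k (l + k)"
    and Q: "?Q \<in> carrier_mat (l + k) m" and J: "?J \<in> carrier_mat (l + k) l"
    using carriers PC VM by auto
  \<comment> \<open>The middle factor is block diagonal with an identity block, so it only changes
    the first block column, from \<open>P\<close> to \<open>P * ?G\<close>.\<close>
  have "four_block_mat P ?C (0\<^sub>m k p) ?D
      * four_block_mat ?G (0\<^sub>m p (l + k)) (0\<^sub>m (l + k) q) (1\<^sub>m (l + k))
    = four_block_mat (P * ?G) ?C (0\<^sub>m k q) ?D"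
    by (subst mult_four_block_mat[OF P C zero_carrier_mat D G zero_carrier_mat zero_carrier_mat
          one_carrier_mat])
      (simp add: right_mult_zero_mat[OF P] right_mult_zero_mat[OF C] right_mult_zero_mat[OF D]
        right_mult_one_mat[OF C] right_mult_one_mat[OF D] left_mult_zero_mat[OF G]
        right_add_zero_mat[OF PG] left_add_zero_mat[OF C] left_add_zero_mat[OF D])
  moreover have "four_block_mat (P * ?G) ?C (0\<^sub>m k q) ?D * four_block_mat Z (0\<^sub>m q l) ?Q ?J
    = four_block_mat M F K (0\<^sub>m k l)"
    by (subst mult_four_block_mat[OF PG C zero_carrier_mat D Z zero_carrier_mat Q J])
      (simp add: upper_left products right_mult_zero_mat[OF PG] left_mult_zero_mat[OF Z]
        left_add_zero_mat[OF F] left_add_zero_mat[OF K])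
  ultimately show ?thesis
    by (simp only:)
qed

text \<open>This inverts the left outer factor of the block factorization, where \<open>C\<close> is
  \<open>N * M * Y\<close>. The block \<open>- C\<close> makes the upper right corner
  \<open>- (P * C) + P * C\<close> vanish, and the upper left corner is the assumed
  identity.\<close>

lemma left_block_inverse:
  fixes P :: "'b::comm_ring_1 mat"
  assumes P: "P \<in> carrier_mat n p" and N: "N \<in> carrier_mat p n"
    and F: "F \<in> carrier_mat n l" and V: "V \<in> carrier_mat l n" and C: "C \<in> carrier_mat p k"
    and bezout: "P * N + F * V = 1\<^sub>m n"
  shows "four_block_mat P (F @\<^sub>c P * C) (0\<^sub>m k p) (0\<^sub>m k l @\<^sub>c 1\<^sub>m k)
      * four_block_mat N (- C) (V @\<^sub>r 0\<^sub>m k n) (0\<^sub>m l k @\<^sub>r 1\<^sub>m k) = 1\<^sub>m (n + k)"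
    (is "four_block_mat P ?C _ ?D * four_block_mat N _ ?Q ?J = _")
proof -
  note carriers = P N F V C
  have PC: "P * C \<in> carrier_mat n k"
    using P C by simp
  have "?C * ?Q = F * V" "?C * ?J = P * C" "?D * ?Q = 0\<^sub>m k n" "?D * ?J = 1\<^sub>m k"
    using F V PC
    by (simp_all add: append_cols_mult_append_rows[of _ n l _ k _ n]
        append_cols_mult_append_rows[of _ n l _ k _ k]
        append_cols_mult_append_rows[of _ k l _ k _ n]
        append_cols_mult_append_rows[of _ k l _ k _ k]
        right_mult_zero_mat[OF PC] right_mult_one_mat[OF PC])
  moreover have "- (P * C) + P * C = 0\<^sub>m n k" "- 0\<^sub>m k k + 1\<^sub>m k = (1\<^sub>m k :: 'b mat)"
    by (rule uminus_l_inv_mat[OF PC]) (auto intro!: eq_matI)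
  moreover have "four_block_mat P ?C (0\<^sub>m k p) ?D * four_block_mat N (- C) ?Q ?J
    = four_block_mat (P * N + ?C * ?Q) (- (P * C) + ?C * ?J) (?D * ?Q) (- 0\<^sub>m k k + ?D * ?J)"
    using carriers PC \<open>?D * ?Q = 0\<^sub>m k n\<close>
    by (subst mult_four_block_mat[of _ n p _ "l + k" _ k _ _ n _ k]) auto
  ultimately show ?thesis
    by (simp add: bezout)
qed

text \<open>This inverts the right outer factor of the block factorization, with \<open>V\<close> in
  the place of \<open>V * M\<close> there. The lower left corner of the product is \<open>V\<close>
  minus \<open>V * (B * Z + Y * K)\<close>, hence zero.\<close>

lemma right_block_inverse:
  fixes Z :: "'b::comm_ring_1 mat"
  assumes B: "B \<in> carrier_mat m q" and Z: "Z \<in> carrier_mat q m"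
    and Y: "Y \<in> carrier_mat m k" and K: "K \<in> carrier_mat k m" and V: "V \<in> carrier_mat l m"
    and bezout: "B * Z + Y * K = 1\<^sub>m m"
  shows "four_block_mat B (0\<^sub>m m l @\<^sub>c Y) (- (V * B)) (1\<^sub>m l @\<^sub>c - (V * Y))
      * four_block_mat Z (0\<^sub>m q l) (V @\<^sub>r K) (1\<^sub>m l @\<^sub>r 0\<^sub>m k l) = 1\<^sub>m (m + l)"
    (is "four_block_mat B ?C _ ?D * four_block_mat Z _ ?Q ?J = _")
proof -
  note carriers = B Z Y K V
  have "?C * ?Q = Y * K" "?C * ?J = 0\<^sub>m m l" "?D * ?Q = V + - (V * Y) * K" "?D * ?J = 1\<^sub>m l"
    using carriers by (subst append_cols_mult_append_rows; auto)+
  moreover have "- (V * B) * Z + (V + - (V * Y) * K) = 0\<^sub>m l m"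
  proof -
    let ?S = "V * (B * Z)" and ?T = "V * (Y * K)"
    have ST: "?S \<in> carrier_mat l m" "?T \<in> carrier_mat l m"
      using carriers by auto
    have "V = V * (B * Z + Y * K)"
      using V by (simp add: bezout)
    also have "\<dots> = ?S + ?T"
      using carriers by (intro mult_add_distrib_mat) auto
    finally have V_eq: "V = ?S + ?T" .
    have "- A + (A + B + - B) = 0\<^sub>m l m"
      if "A \<in> carrier_mat l m" "B \<in> carrier_mat l m" for A B :: "'b mat"
      using that by (intro eq_matI) auto
    from this[OF ST] have "- ?S + (?S + ?T + - ?T) = 0\<^sub>m l m" .
    moreover have "- (V * B) * Z = - ?S" "- (V * Y) * K = - ?T"
      using carriers by (simp_all add: mult_assoc_dim)
    moreover have "V + - ?T = ?S + ?T + - ?T"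
      using V_eq by (rule arg_cong)
    ultimately show ?thesis
      by (simp only:)
  qed
  ultimately show ?thesis
    using carriers bezout by (subst mult_four_block_mat[of _ m q _ "l + k" _ l _ _ m _ l]) auto
qed

text \<open>This extracts what the argument needs from duality uniformly for empty and nonempty
  \<open>K\<close>. If \<open>K\<close> has no rows, then \<open>q = dim_col K\<close>, and the
  product condition holds because both sides have no rows.\<close>

lemma dual_to_in_cases:
  assumes "dual_to_in N K \<Omega>"
  obtains q where "N \<in> carrier_mat q (dim_col K)" "dim_row K + q = dim_col K"
    "rat_mat K * transpose_mat N = 0\<^sub>m (dim_row K) q"
proof (cases "dim_row K = 0")
  case True
  then show thesis
    using assms by (intro that[of "dim_col K"]) (auto simp: dual_to_in_def intro!: eq_matI)
next
  case False
  then show thesis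
    using assms by (intro that[of "dim_row N"]) (auto simp: dual_to_in_def dual_bases_def)
qed

section \<open>Local factorization of the pencil at each point of \<Omega>\<close>

theorem theorem5p4:
  fixes L M K1 K2 :: "'a::alg_closed_field poly mat"
    and N1 N2 G :: "'a ratfun mat"
    and \<Omega> :: "'a set"
  assumes "block_full_rank_pencil L M K1 K2"
    and "\<Omega> \<noteq> {}"
    and "dual_to_in N1 K1 \<Omega>"
    and "dual_to_in N2 K2 \<Omega>"
    and "full_row_rank_in (rat_mat K1) \<Omega>" and "full_row_rank_in N1 \<Omega>"
    and "full_row_rank_in (rat_mat K2) \<Omega>" and "full_row_rank_in N2 \<Omega>"
    and "G = N2 * rat_mat M * transpose_mat N1"
  shows "linearization_empty_state_in L G \<Omega>"
  unfolding linearization_empty_state_in_def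
proof (intro conjI ballI)
  define n m k l where dims: "n = dim_row M" "m = dim_col M" "k = dim_row K1" "l = dim_row K2"
  have L: "L = four_block_mat M (transpose_mat K2) K1 (0\<^sub>m k l)"
    and cols: "dim_col K1 = m" "dim_col K2 = n"
    using assms(1) by (simp_all add: block_full_rank_pencil_def dims)
  show "pencil L"
    using assms(1) unfolding block_full_rank_pencil_def by blast
  obtain q where N1: "N1 \<in> carrier_mat q m" "k + q = m"
    and dual1: "rat_mat K1 * transpose_mat N1 = 0\<^sub>m k q"
    using assms(3) by (rule dual_to_in_cases) (simp add: cols flip: dims)
  obtain p where N2: "N2 \<in> carrier_mat p n" "l + p = n"
    and dual2: "rat_mat K2 * transpose_mat N2 = 0\<^sub>m l p"
    using assms(4) by (rule dual_to_in_cases) (simp add: cols flip: dims)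
  let ?M = "rat_mat M" and ?K1 = "rat_mat K1" and ?F = "transpose_mat (rat_mat K2)"
    and ?B = "transpose_mat N1"
  have M: "?M \<in> carrier_mat n m" and K1: "?K1 \<in> carrier_mat k m"
    and K2: "rat_mat K2 \<in> carrier_mat l n"
    by (auto simp: dims cols[unfolded dims])
  have F: "?F \<in> carrier_mat n l" and B: "?B \<in> carrier_mat m q"
    using K2 N1 by auto
  have ratL: "rat_mat L = four_block_mat ?M ?F ?K1 (0\<^sub>m k l)"
    using M K1 K2 unfolding L by (intro eq_matI) auto
  fix a
  assume a: "a \<in> \<Omega>"
  have npN: "no_pole_mat N1 a" "no_pole_mat N2 a"
    using assms(6,8) a by (simp_all add: full_row_rank_in_def)
  obtain Y Z where Y: "Y \<in> carrier_mat m k" and Z: "Z \<in> carrier_mat q m"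
    and npYZ: "no_pole_mat Y a" "no_pole_mat Z a" and bezout1: "?B * Z + Y * ?K1 = 1\<^sub>m m"
    using no_pole_dual_bezout[OF K1 N1 dual1 assms(5,6) a] by blast
  obtain W X where W: "W \<in> carrier_mat n l" and X: "X \<in> carrier_mat p n"
    and npWX: "no_pole_mat W a" "no_pole_mat X a"
    and "transpose_mat N2 * X + W * rat_mat K2 = 1\<^sub>m n"
    using no_pole_dual_bezout[OF K2 N2 dual2 assms(7,8) a] by blast
  \<comment> \<open>\<open>N2\<close> and the transpose of \<open>K2\<close> act on the row side of
    \<open>M\<close>, so the second identity is needed in transposed form.\<close>
  then have "transpose_mat (transpose_mat N2 * X + W * rat_mat K2) = 1\<^sub>m n"
    by simp
  moreover define P V where "P = transpose_mat X" and "V = transpose_mat W"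
  ultimately have bezout2: "P * N2 + ?F * V = 1\<^sub>m n"
    using W X N2 K2 by (simp add: transpose_add[of _ n n] transpose_mult[of _ n p]
        transpose_mult[of _ n l])
  have P: "P \<in> carrier_mat n p" and V: "V \<in> carrier_mat l n"
    and npPV: "no_pole_mat P a" "no_pole_mat V a"
    using W X npWX by (simp_all add: P_def V_def no_pole_transpose_mat)
  have C: "N2 * ?M * Y \<in> carrier_mat p k" and VM: "V * ?M \<in> carrier_mat l m"
    using N2 M Y V by auto
  have npC: "no_pole_mat (N2 * ?M * Y) a" and npVM: "no_pole_mat (V * ?M) a"
    using N2 M Y V npN npYZ npPV by (auto intro!: no_pole_times_mat)
  define R1 where
    "R1 = four_block_mat P (?F @\<^sub>c P * (N2 * ?M * Y)) (0\<^sub>m k p) (0\<^sub>m k l @\<^sub>c 1\<^sub>m k)"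
  define R2 where
    "R2 = four_block_mat Z (0\<^sub>m q l) (V * ?M @\<^sub>r ?K1) (1\<^sub>m l @\<^sub>r 0\<^sub>m k l)"
  \<comment> \<open>\<open>?S1\<close> is the right inverse of \<open>R1\<close> and
    \<open>?S2\<close> the left inverse of \<open>R2\<close>.\<close>
  let ?S1 = "four_block_mat N2 (- (N2 * ?M * Y)) (V @\<^sub>r 0\<^sub>m k n) (0\<^sub>m l k @\<^sub>r 1\<^sub>m k)"
    and ?S2 = "four_block_mat ?B (0\<^sub>m m l @\<^sub>c Y) (- (V * ?M * ?B)) (1\<^sub>m l @\<^sub>c - (V * ?M * Y))"
  have PC: "P * (N2 * ?M * Y) \<in> carrier_mat n k" and VMY: "V * ?M * Y \<in> carrier_mat l k"
    using P C VM Y by simp_all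
  have npPC: "no_pole_mat (P * (N2 * ?M * Y)) a"
    by (intro no_pole_times_mat npPV npC) (use P C in auto)
  have npVMB: "no_pole_mat (V * ?M * ?B) a"
    by (intro no_pole_times_mat npVM no_pole_transpose_mat npN) (use VM B in auto)
  have npVMY: "no_pole_mat (V * ?M * Y) a"
    by (intro no_pole_times_mat npVM npYZ) (use VM Y in auto)
  note no_pole_intros = no_pole_four_block_mat no_pole_append_rows no_pole_append_cols
    no_pole_transpose_mat no_pole_uminus_mat no_pole_zero_mat no_pole_one_mat no_pole_rat_mat
  have "no_pole_mat R1 a"
    unfolding R1_def
    by (intro no_pole_intros npPV npPC) (use P F PC in \<open>auto simp: append_cols_def\<close>)
  moreover have "no_pole_mat R2 a"
    unfolding R2_def
    by (intro no_pole_intros npYZ npVM) (use Z VM K1 in \<open>auto simp: append_rows_def\<close>)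
  moreover have "no_pole_mat ?S1 a"
    by (intro no_pole_intros npPV npN npC) (use N2 C V in \<open>auto simp: append_rows_def\<close>)
  moreover have "no_pole_mat ?S2 a"
    by (intro no_pole_intros npYZ npN npVMB npVMY)
      (use B Y VM in \<open>auto simp: append_cols_def\<close>)
  \<comment> \<open>The rows and columns of the outer factors are partitioned differently: those of
    \<open>R1\<close> as \<open>n + k\<close> and \<open>p + (l + k)\<close>, those of
    \<open>R2\<close> as \<open>q + (l + k)\<close> and \<open>m + l\<close>. Duality makes the
    totals agree, so both factors are square.\<close>
  moreover have sizes: "p + (l + k) = n + k" "q + (l + k) = m + l"
    using N1(2) N2(2) by simp_all
  have corners: "(0\<^sub>m k l @\<^sub>c 1\<^sub>m k :: 'a ratfun mat) \<in> carrier_mat k (l + k)"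
    "(1\<^sub>m l @\<^sub>r 0\<^sub>m k l :: 'a ratfun mat) \<in> carrier_mat (l + k) l"
    "(0\<^sub>m l k @\<^sub>r 1\<^sub>m k :: 'a ratfun mat) \<in> carrier_mat (l + k) k"
    "1\<^sub>m l @\<^sub>c - (V * ?M * Y) \<in> carrier_mat l (l + k)"
    using VMY by simp_all
  have R1: "R1 \<in> carrier_mat (p + (l + k)) (p + (l + k))"
    using four_block_carrier_mat[OF P corners(1)] unfolding R1_def sizes(1) .
  have R2: "R2 \<in> carrier_mat (q + (l + k)) (q + (l + k))"
    using four_block_carrier_mat[OF Z corners(2)] unfolding R2_def sizes(2) .
  have S1: "?S1 \<in> carrier_mat (p + (l + k)) (p + (l + k))"
    using four_block_carrier_mat[OF N2(1) corners(3)] unfolding sizes(1) .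
  have S2: "?S2 \<in> carrier_mat (q + (l + k)) (q + (l + k))"
    using four_block_carrier_mat[OF B corners(4)] unfolding sizes(2) .
  moreover have "R1 * ?S1 = 1\<^sub>m (p + (l + k))"
    unfolding R1_def sizes by (rule left_block_inverse[OF P N2(1) F V C bezout2])
  moreover have "?S2 * R2 = 1\<^sub>m (q + (l + k))"
    unfolding R2_def sizes by (rule right_block_inverse[OF B Z Y K1 VM bezout1])
  ultimately have reg1: "regular_at R1 a" and reg2: "regular_at R2 a"
    using regular_at_if_inverse(1)[OF R1 S1] regular_at_if_inverse(2)[OF S2 R2] by auto
  have G: "G \<in> carrier_mat p q"
    using assms(9) N1 N2 M by auto
  have "diag_block_mat [G, 1\<^sub>m (l + k)]
      = four_block_mat G (0\<^sub>m p (l + k)) (0\<^sub>m (l + k) q) (1\<^sub>m (l + k))"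
    using G by (auto simp: four_block_mat_empty)
  then have "R1 * diag_block_mat [G, 1\<^sub>m (l + k)] * R2 = rat_mat L"
    unfolding R1_def R2_def ratL assms(9)
    by (simp only: block_factorization[OF M B Z Y K1 P N2(1) F V bezout1 bezout2])
  also have "rat_mat L = diag_block_mat [rat_mat L, 1\<^sub>m 0]"
    by (rule eq_matI) (auto simp: Let_def)
  finally have "R1 * diag_block_mat [G, 1\<^sub>m (l + k)] * R2 = diag_block_mat [rat_mat L, 1\<^sub>m 0]" .
  moreover have "dim_row L = n + k" "dim_col L = m + l"
    by (auto simp: L dims)
  \<comment> \<open>The witnesses are \<open>s1 = l + k\<close> and \<open>s2 = 0\<close>:
    \<open>L\<close> is \<open>n + k\<close> by \<open>m + l\<close> and \<open>G\<close> is
    \<open>p\<close> by \<open>q\<close>, and both size differences equal \<open>l + k\<close>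
    because \<open>n = l + p\<close> and \<open>m = k + q\<close>.\<close>
  ultimately show "\<exists>s1 s2 R1 R2.
        int s1 - int s2 = int (dim_row L) - int (dim_row G) \<and>
        int s1 - int s2 = int (dim_col L) - int (dim_col G) \<and>
        R1 \<in> carrier_mat (dim_row G + s1) (dim_row G + s1) \<and> regular_at R1 a \<and>
        R2 \<in> carrier_mat (dim_col G + s1) (dim_col G + s1) \<and> regular_at R2 a \<and>
        R1 * diag_block_mat [G, 1\<^sub>m s1] * R2 = diag_block_mat [rat_mat L, 1\<^sub>m s2]"
    using R1 R2 reg1 reg2 G N1(2) N2(2)
    by (intro exI[of _ "l + k"] exI[of _ 0] exI[of _ R1] exI[of _ R2]) auto
qed

end
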